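(* Fix $r\in(0,1)$ and let $A_r=\{z\in\mathbb{C}: r<|z|<1\}$. For any $z\in A_r$, $$H^k_{A_r}(z)=\frac{\sqrt{(1-\lambda^2)^2+4\lambda^2\sin^2\theta(z)}-2\lambda\sin\theta(z)}{1-\lambda^2},$$ where $\lambda=\exp\left(\frac{\pi^2}{\ln r}\right)$ and $\theta(z)=\frac{\pi\ln|z|}{\ln r}$.
   Context: $\mathbb{D}$ is the open unit disk in $\mathbb{C}$, and $\rho_{\mathbb{D}}$ is the Poincaré distance on $\mathbb{D}$ with density $\frac{2}{1-|z|^2}$. For a Riemann surface $X$, the Kobayashi pseudo-distance is $k_X(z_1,z_2)=\inf \sum_{i=1}^m\rho_{\mathbb{D}}(a_i,b_i)$, the infimum over all $m\ge1$, $a_i,b_i\in\mathbb{D}$ and holomorphic $f_i:\mathbb{D}\to X$ with $f_1(a_1)=z_1$, $f_i(b_i)=f_{i+1}(a_{i+1})$ for $1\le i<m$, and $f_m(b_m)=z_2$. Put $B^k_X(z;s)=\{w\in X: k_X(z,w)<s\}$. The Fridman function of $X$ with respect to the Kobayashi metric is $$H^k_X(z)=\sup\{\tanh\tfrac s2 : s>0,\ B^k_X(z;s)\subset f(\mathbb{D})\text{ for some injective holomorphic } f:\mathbb{D}\to X\}.$$ *)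

theory Defs
  imports "HOL-Complex_Analysis.Complex_Analysis"
begin

abbreviation unit_disk :: "complex set" where
  "unit_disk \<equiv> ball 0 1"

definition poincare_density :: "complex \<Rightarrow> real" where
  "poincare_density z = 2 / (1 - (norm z)\<^sup>2)"

text \<open>
  A \<open>valid_path\<close> is continuous and continuously differentiable off a finite set, but its speed
  may be unbounded near the exceptional points, so it can have infinite length.  Since
  \<open>integral\<close> would be \<open>0\<close> for such a path, the length is expressed by \<open>has_integral\<close>, which
  makes the infimum range over the paths of finite length only.
\<close>

definition poincare_dist :: "complex \<Rightarrow> complex \<Rightarrow> real" where
  "poincare_dist a b = Inf {L. \<exists>\<gamma>. valid_path \<gamma> \<and> path_image \<gamma> \<subseteq> unit_disk \<and>
      pathstart \<gamma> = a \<and> pathfinish \<gamma> = b \<and>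
      ((\<lambda>t. poincare_density (\<gamma> t) * norm (vector_derivative \<gamma> (at t within {0..1})))
         has_integral L) {0..1}}"

text \<open>
  The definitions below are for plane domains, that is, nonempty connected open \<open>X\<close>.  Any two
  points of \<open>X\<close> are then joined by a chain of discs, so the infimum, taken in the reals, is over
  a nonempty set of nonnegative numbers.
\<close>

definition kobayashi_chain ::
  "complex set \<Rightarrow> complex \<Rightarrow> complex \<Rightarrow> nat \<Rightarrow> (nat \<Rightarrow> complex) \<Rightarrow> (nat \<Rightarrow> complex) \<Rightarrow>
    (nat \<Rightarrow> complex \<Rightarrow> complex) \<Rightarrow> bool" where
  "kobayashi_chain X z w m a b f \<longleftrightarrow>
     m \<ge> 1 \<and>
     (\<forall>i\<in>{1..m}. a i \<in> unit_disk \<and> b i \<in> unit_disk \<and>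
        f i holomorphic_on unit_disk \<and> f i ` unit_disk \<subseteq> X) \<and>
     f 1 (a 1) = z \<and>
     (\<forall>i\<in>{1..<m}. f i (b i) = f (i + 1) (a (i + 1))) \<and>
     f m (b m) = w"

definition kobayashi_dist :: "complex set \<Rightarrow> complex \<Rightarrow> complex \<Rightarrow> real" where
  "kobayashi_dist X z w =
     Inf {\<Sum>i=1..m. poincare_dist (a i) (b i) | m a b f. kobayashi_chain X z w m a b f}"

definition kobayashi_ball :: "complex set \<Rightarrow> complex \<Rightarrow> real \<Rightarrow> complex set" where
  "kobayashi_ball X z s = {w \<in> X. kobayashi_dist X z w < s}"

text \<open>
  The supremum is also taken in the reals.  Its set is bounded above by \<open>1\<close>; it is empty for
  \<open>X = UNIV\<close>, for instance, and then the value is meaningless.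
\<close>

definition fridman_kobayashi :: "complex set \<Rightarrow> complex \<Rightarrow> real" where
  "fridman_kobayashi X z =
     Sup {tanh (s / 2) | s. s > 0 \<and>
       (\<exists>f. f holomorphic_on unit_disk \<and> inj_on f unit_disk \<and> f ` unit_disk \<subseteq> X \<and>
            kobayashi_ball X z s \<subseteq> f ` unit_disk)}"

definition annulus :: "real \<Rightarrow> complex set" where
  "annulus r = {z. r < norm z \<and> norm z < 1}"

end

(* The map w |-> z exp (- i ln r (w - i theta) / pi) is a universal covering of the annulus by the
   strip 0 < Im w < pi; it sends i theta to z and has deck translations by 2 q, q = - pi^2 / ln r.
   Transported to the disc with i theta at 0 it becomes a covering P with P 0 = z. Discs in the
   annulus lift through P, so by Schwarz-Pick the Kobayashi ball of radius s about z is the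
   P-image of the disc |b| < tanh (s/2).
   Let R be the least modulus of a point of the disc that corresponds to a point with |Re w| >= q.
   Two points identified by P differ by a multiple of 2 q in the strip, so P is injective on
   |b| < R and the restriction of P to this disc serves every s with tanh (s/2) <= R. A larger
   Kobayashi ball contains the image of a path from Re w = -q to Re w = q, which winds once around
   0, so no simply connected subset of the annulus contains it. Finally R is computed by
   minimising an explicit function of Im w on the line Re w = q. *)

theory Submission
  imports Defs
begin

section \<open>The Poincare distance\<close>

lemma one_minus_norm_square_pos: "norm u < 1 \<Longrightarrow> 1 - (norm u)\<^sup>2 > 0"
  by (simp add: abs_square_less_1)

lemma artanh_compose_has_real_derivative:
  fixes g :: "real \<Rightarrow> real"
  assumes "(g has_real_derivative g') (at t within A)" "\<bar>g t\<bar> < 1"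
  shows "((\<lambda>t. artanh (g t)) has_real_derivative g' / (1 - (g t)\<^sup>2)) (at t within A)"
  using DERIV_chain2[OF artanh_real_has_field_derivative[OF assms(2), of UNIV] assms(1)] by simp

lemma poincare_density_pos: "norm v < 1 \<Longrightarrow> poincare_density v > 0"
  unfolding poincare_density_def by (simp add: abs_square_less_1)

text \<open>Disc automorphisms taking 0 to \<open>v\<close> and \<open>F v\<close> to 0 turn
  \<open>F\<close> into a self-map \<open>G\<close> of the disc fixing 0. The Schwarz lemma bounds
  the derivative of \<open>G\<close> at 0, and the chain rule translates that bound back to
  \<open>v\<close>.\<close>

lemma Schwarz_Pick_deriv:
  assumes hol: "F holomorphic_on unit_disk" and img: "F ` unit_disk \<subseteq> unit_disk"
    and v: "norm v < 1"
  shows "norm (deriv F v) * poincare_density (F v) \<le> poincare_density v"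
proof -
  define G where "G = Moebius_function 0 (F v) \<circ> F \<circ> Moebius_function 0 (- v)"
  have Fv: "norm (F v) < 1" using img v by (simp add: image_subset_iff)
  note nz = less_imp_neq[OF one_minus_norm_square_pos, symmetric] one_minus_norm_square_pos
  have m: "Moebius_function 0 (- v) ` unit_disk \<subseteq> unit_disk"
    using Moebius_function_norm_lt_1 [of "-v"] v by auto
  have holG: "G holomorphic_on unit_disk"
    unfolding G_def
    by (intro holomorphic_on_compose_gen[OF _ _ img] holomorphic_on_compose_gen[OF _ _ m] hol
          Moebius_function_holomorphic holomorphic_on_compose_gen[OF _ Moebius_function_holomorphic])
       (use v Fv m img in auto)
  have G0: "G 0 = 0"
    by (simp add: G_def Moebius_function_simple)
  have "norm (G u) < 1" if "norm u < 1" for u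
    using m img that Fv by (auto simp: G_def image_subset_iff intro!: Moebius_function_norm_lt_1)
  from Schwarz_Lemma(2)[OF holG G0 this, of 0] have le: "norm (deriv G 0) \<le> 1" by auto
  have sq: "cnj u * u = of_real ((norm u)\<^sup>2)" for u
    by (metis complex_norm_square mult.commute)
  have d1: "(Moebius_function 0 (- v) has_field_derivative of_real (1 - (norm v)\<^sup>2)) (at 0)"
    unfolding Moebius_function_simple[abs_def]
    by (auto intro!: derivative_eq_intros simp: complex_norm_square[symmetric])
  have ne: "1 - cnj (F v) * F v \<noteq> 0"
    using nz(1)[OF Fv] unfolding sq by (metis of_real_1 of_real_diff of_real_eq_0_iff)
  have d3: "(Moebius_function 0 (F v) has_field_derivative of_real (1 / (1 - (norm (F v))\<^sup>2))) (at (F v))"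
    unfolding Moebius_function_simple[abs_def]
    by (rule derivative_eq_intros refl ne)+ (use ne in \<open>simp add: sq divide_simps\<close>)
  have d2: "(F has_field_derivative deriv F v) (at v)"
    using holomorphic_derivI[OF hol] v by auto
  have mv: "Moebius_function 0 (- v) 0 = v" by (simp add: Moebius_function_simple)
  have "(G has_field_derivative of_real (1 / (1 - (norm (F v))\<^sup>2)) * (deriv F v * of_real (1 - (norm v)\<^sup>2))) (at 0)"
    unfolding G_def comp_assoc
    by (intro DERIV_chain) (use d1 d2 d3 mv in \<open>auto simp: o_def\<close>)
  then have "deriv G 0 = of_real (1 / (1 - (norm (F v))\<^sup>2)) * (deriv F v * of_real (1 - (norm v)\<^sup>2))"
    by (rule DERIV_imp_deriv)
  with le have "norm (deriv F v) * (1 - (norm v)\<^sup>2) / (1 - (norm (F v))\<^sup>2) \<le> 1"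
    using nz(2)[OF Fv] nz(2)[OF v] by (simp add: norm_mult norm_divide abs_of_pos del: of_real_diff of_real_power)
  then show ?thesis
    using nz(2)[OF Fv] nz(2)[OF v] by (simp add: poincare_density_def divide_simps mult_ac)
qed

abbreviation poincare_length :: "(real \<Rightarrow> complex) \<Rightarrow> real \<Rightarrow> bool" where
  "poincare_length \<gamma> L \<equiv> ((\<lambda>t. poincare_density (\<gamma> t) *
      norm (vector_derivative \<gamma> (at t within {0..1}))) has_integral L) {0..1}"

lemma poincare_length_nonneg:
  assumes "path_image \<gamma> \<subseteq> unit_disk" "poincare_length \<gamma> L"
  shows "L \<ge> 0"
proof (rule has_integral_nonneg[OF assms(2)])
  fix t :: real assume "t \<in> {0..1}"
  then have "\<gamma> t \<in> unit_disk" using assms(1) by (auto simp only: path_image_def)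
  then show "0 \<le> poincare_density (\<gamma> t) * norm (vector_derivative \<gamma> (at t within {0..1}))"
    by (simp add: less_imp_le[OF poincare_density_pos])
qed

lemma closed_segment_unit_disk:
  "a \<in> unit_disk \<Longrightarrow> b \<in> unit_disk \<Longrightarrow> path_image (linepath a b) \<subseteq> unit_disk"
  by (simp add: closed_segment_subset)

text \<open>The segment shows that the infimum defining \<open>poincare_dist\<close> runs over a
  nonempty set, so that lower bounds for path lengths pass to it.\<close>

lemma poincare_length_linepath_exists:
  assumes "a \<in> unit_disk" "b \<in> unit_disk"
  obtains L where "poincare_length (linepath a b) L"
proof -
  have "linepath a b t \<in> unit_disk" if "t \<in> {0..1}" for t
    using closed_segment_unit_disk[OF assms] that by (simp add: path_image_def image_subset_iff)
  then have "1 - (norm (linepath a b t))\<^sup>2 \<noteq> 0" if "t \<in> {0..1}" for t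
    using one_minus_norm_square_pos[of "linepath a b t"] that by auto
  then have "continuous_on {0..1} (\<lambda>t. poincare_density (linepath a b t) * norm (b - a))"
    unfolding poincare_density_def by (intro continuous_intros) auto
  then have "(\<lambda>t. poincare_density (linepath a b t) * norm (b - a)) integrable_on {0..1}"
    by (rule integrable_continuous_real)
  then obtain L where "((\<lambda>t. poincare_density (linepath a b t) * norm (b - a)) has_integral L) {0..1}"
    by blast
  then have "poincare_length (linepath a b) L"
    by (subst has_integral_cong) (auto simp: vector_derivative_linepath_within)
  with that show thesis .
qed

lemma poincare_dist_le:
  assumes "valid_path \<gamma>" "path_image \<gamma> \<subseteq> unit_disk" "poincare_length \<gamma> L"
  shows "poincare_dist (pathstart \<gamma>) (pathfinish \<gamma>) \<le> L"
  unfolding poincare_dist_def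
  by (rule cInf_lower) (use assms poincare_length_nonneg in \<open>auto intro!: bdd_belowI[of _ 0]\<close>)

lemma poincare_dist_ge:
  assumes "a \<in> unit_disk" "b \<in> unit_disk"
    and "\<And>\<gamma> L. \<lbrakk>valid_path \<gamma>; path_image \<gamma> \<subseteq> unit_disk; pathstart \<gamma> = a; pathfinish \<gamma> = b;
           poincare_length \<gamma> L\<rbrakk> \<Longrightarrow> l \<le> L"
  shows "l \<le> poincare_dist a b"
proof -
  obtain L where "poincare_length (linepath a b) L"
    using poincare_length_linepath_exists[OF assms(1,2)] .
  then show ?thesis
    unfolding poincare_dist_def
    by (intro cInf_greatest) (use assms(3) closed_segment_unit_disk[OF assms(1,2)] in
        \<open>fastforce intro!: exI[of _ "linepath a b"]\<close>)+
qed

lemma poincare_dist_nonneg: "a \<in> unit_disk \<Longrightarrow> b \<in> unit_disk \<Longrightarrow> 0 \<le> poincare_dist a b"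
  by (rule poincare_dist_ge) (auto dest: poincare_length_nonneg)

text \<open>Along the radius to \<open>b\<close> the density has the primitive
  \<open>2 * artanh (t * norm b)\<close>.\<close>

lemma poincare_dist_0_le:
  assumes b: "norm b < 1"
  shows "poincare_dist 0 b \<le> 2 * artanh (norm b)"
proof -
  have small: "\<bar>t * norm b\<bar> < 1" if "t \<in> {0..1}" for t
  proof -
    have "\<bar>t * norm b\<bar> \<le> 1 * norm b"
      unfolding abs_mult by (intro mult_mono) (use that in auto)
    then show ?thesis using b by simp
  qed
  have D: "((\<lambda>t. 2 * artanh (t * norm b)) has_vector_derivative
      poincare_density (t *\<^sub>R b) * norm b) (at t within {0..1})" if "t \<in> {0..1}" for t
    unfolding has_real_derivative_iff_has_vector_derivative[symmetric]
    using small[OF that]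
    by (auto intro!: derivative_eq_intros artanh_compose_has_real_derivative
        simp: poincare_density_def power_mult_distrib)
  have "((\<lambda>t. poincare_density (t *\<^sub>R b) * norm b) has_integral
      2 * artanh (1 * norm b) - 2 * artanh (0 * norm b)) {0..1}"
    by (intro fundamental_theorem_of_calculus) (use D in auto)
  then have "poincare_length (linepath 0 b) (2 * artanh (norm b))"
    by (subst has_integral_cong[where g = "\<lambda>t. poincare_density (t *\<^sub>R b) * norm b"])
       (auto simp: vector_derivative_linepath_within linepath_0')
  from poincare_dist_le[OF valid_path_linepath closed_segment_unit_disk this] show ?thesis
    using b by (simp add: pathstart_def pathfinish_def)
qed

text \<open>Working with the real part instead of the modulus keeps the potential function smooth;
  the modulus is recovered by a rotation.\<close>

lemma artanh_Re_diff_le_poincare_dist: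
  assumes hol: "F holomorphic_on unit_disk" and img: "F ` unit_disk \<subseteq> unit_disk"
    and a: "a \<in> unit_disk" and b: "b \<in> unit_disk"
  shows "2 * artanh (Re (F b)) - 2 * artanh (Re (F a)) \<le> poincare_dist a b"
proof (rule poincare_dist_ge[OF a b])
  fix \<gamma> L
  assume vp: "valid_path \<gamma>" and pim: "path_image \<gamma> \<subseteq> unit_disk"
    and st: "pathstart \<gamma> = a" "pathfinish \<gamma> = b" and L: "poincare_length \<gamma> L"
  obtain S where cont: "continuous_on {0..1} \<gamma>" and "finite S"
    and C1: "\<gamma> C1_differentiable_on ({0..1} - S)"
    using vp by (auto simp: valid_path_def piecewise_C1_differentiable_on_def)
  have \<gamma>D: "\<gamma> t \<in> unit_disk" if "t \<in> {0..1}" for t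
    using pim that by (simp add: path_image_def image_subset_iff)
  have Re1: "\<bar>Re u\<bar> < 1" if "u \<in> unit_disk" for u
    using that abs_Re_le_cmod[of u] by simp
  have FD: "F (\<gamma> t) \<in> unit_disk" if "t \<in> {0..1}" for t
    using img \<gamma>D[OF that] by blast
  define \<Phi>' where "\<Phi>' t = 2 * (Re (deriv F (\<gamma> t) * vector_derivative \<gamma> (at t)) /
      (1 - (Re (F (\<gamma> t)))\<^sup>2))" for t
  have deriv: "((\<lambda>t. 2 * artanh (Re (F (\<gamma> t)))) has_vector_derivative \<Phi>' t) (at t)"
    if t: "t \<in> {0<..<1} - S" for t
  proof -
    have "(\<gamma> has_vector_derivative vector_derivative \<gamma> (at t)) (at t)"
      using C1 t by (simp add: C1_differentiable_on_eq vector_derivative_works)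
    moreover have "(F has_field_derivative deriv F (\<gamma> t)) (at (\<gamma> t))"
      using holomorphic_derivI[OF hol] \<gamma>D t by auto
    ultimately have "(F \<circ> \<gamma> has_vector_derivative vector_derivative \<gamma> (at t) * deriv F (\<gamma> t)) (at t)"
      by (rule field_vector_diff_chain_at)
    then have "((\<lambda>t. Re (F (\<gamma> t))) has_vector_derivative
        Re (deriv F (\<gamma> t) * vector_derivative \<gamma> (at t))) (at t)"
      by (auto dest!: bounded_linear.has_vector_derivative[OF bounded_linear_Re] simp: mult.commute)
    then show ?thesis
      unfolding has_real_derivative_iff_has_vector_derivative[symmetric] \<Phi>'_def
      by (intro DERIV_cmult artanh_compose_has_real_derivative Re1[OF FD]) (use t in auto)
  qed
  have contF: "continuous_on {0..1} (\<lambda>t. F (\<gamma> t))"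
    by (rule continuous_on_compose2[OF holomorphic_on_imp_continuous_on[OF hol] cont])
       (use \<gamma>D in auto)
  have "(\<Phi>' has_integral 2 * artanh (Re (F (\<gamma> 1))) - 2 * artanh (Re (F (\<gamma> 0)))) {0..1}"
  proof (rule fundamental_theorem_of_calculus_interior_strong[OF \<open>finite S\<close>])
    show "continuous_on {0..1} (\<lambda>t. 2 * artanh (Re (F (\<gamma> t))))"
      by (intro continuous_intros contF) (use Re1[OF FD] in \<open>simp_all add: abs_less_iff minus_less_iff\<close>)
  qed (use deriv in auto)
  \<comment> \<open>Changing the integrand on a finite set keeps its integral. At the exceptional
    points \<open>\<Phi>'\<close> is then compared with itself, so a speed estimate there is
    avoided.\<close>
  moreover have "((\<lambda>t. if t \<in> S \<union> {0,1} then \<Phi>' t else poincare_density (\<gamma> t) *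
      norm (vector_derivative \<gamma> (at t within {0..1}))) has_integral L) {0..1}"
    by (rule has_integral_spike_finite[OF _ _ L, of "S \<union> {0,1}"]) (use \<open>finite S\<close> in auto)
  ultimately have "2 * artanh (Re (F (\<gamma> 1))) - 2 * artanh (Re (F (\<gamma> 0))) \<le> L"
  proof (rule has_integral_le)
    fix t :: real assume t01: "t \<in> {0..1}"
    have "\<Phi>' t \<le> poincare_density (\<gamma> t) * norm (vector_derivative \<gamma> (at t within {0..1}))"
      if t: "t \<in> {0<..<1}"
    proof -
      let ?d = "vector_derivative \<gamma> (at t)"
      have w: "vector_derivative \<gamma> (at t within {0..1}) = ?d"
        using at_within_interior[of t "{0..1}"] t by simp
      have F1: "norm (F (\<gamma> t)) < 1" using FD t by auto
      have "Re (deriv F (\<gamma> t) * ?d) \<le> norm (deriv F (\<gamma> t)) * norm ?d"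
        using complex_Re_le_cmod[of "deriv F (\<gamma> t) * ?d"] by (simp add: norm_mult)
      \<comment> \<open>Passing from the real part to the modulus shrinks the denominator, so
        \<open>\<Phi>'\<close> is at most the hyperbolic speed of the image path, which Schwarz-Pick
        bounds by that of \<open>\<gamma>\<close>.\<close>
      moreover have "1 - (norm (F (\<gamma> t)))\<^sup>2 \<le> 1 - (Re (F (\<gamma> t)))\<^sup>2"
        using abs_Re_le_cmod[of "F (\<gamma> t)"] by (simp add: abs_le_square_iff[symmetric])
      moreover have "0 < 1 - (norm (F (\<gamma> t)))\<^sup>2"
        using F1 by (simp add: abs_square_less_1)
      ultimately have "\<Phi>' t \<le> 2 * (norm (deriv F (\<gamma> t)) * norm ?d / (1 - (norm (F (\<gamma> t)))\<^sup>2))"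
        unfolding \<Phi>'_def by (intro mult_left_mono frac_le) auto
      also have "\<dots> = norm (deriv F (\<gamma> t)) * poincare_density (F (\<gamma> t)) * norm ?d"
        by (simp add: poincare_density_def)
      also have "\<dots> \<le> poincare_density (\<gamma> t) * norm ?d"
        by (intro mult_right_mono Schwarz_Pick_deriv hol img) (use \<gamma>D t in auto)
      finally show ?thesis by (simp add: w)
    qed
    then show "\<Phi>' t \<le> (if t \<in> S \<union> {0,1} then \<Phi>' t else poincare_density (\<gamma> t) *
      norm (vector_derivative \<gamma> (at t within {0..1})))"
      using t01 by auto
  qed
  with st show "2 * artanh (Re (F b)) - 2 * artanh (Re (F a)) \<le> L"
    by (simp add: pathstart_def pathfinish_def)
qed

section \<open>Monotonicity of artanh, and growth of the distance from 0 under disc maps\<close>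

lemma tanh_artanh_real:
  assumes "\<bar>x\<bar> < (1::real)"
  shows "tanh (artanh x) = x"
proof -
  have pos: "0 < (1 + x) / (1 - x)" using assms by (simp add: abs_less_iff)
  have e: "exp (- 2 * artanh x) = (1 - x) / (1 + x)"
    using pos by (simp add: artanh_def exp_minus)
  then show ?thesis
    using assms unfolding tanh_real_altdef e by (simp add: divide_simps abs_less_iff)
qed

lemma artanh_less_iff:
  assumes "\<bar>x\<bar> < (1::real)"
  shows "artanh x < y \<longleftrightarrow> x < tanh y"
  using tanh_real_less_iff[of "artanh x" y] by (simp add: tanh_artanh_real[OF assms])

lemma artanh_le_iff:
  assumes "\<bar>x\<bar> < (1::real)" "\<bar>y\<bar> < 1"
  shows "artanh x \<le> artanh y \<longleftrightarrow> x \<le> y"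
  using tanh_real_le_iff[of "artanh x" "artanh y"]
  by (simp add: tanh_artanh_real[OF assms(1)] tanh_artanh_real[OF assms(2)])

text \<open>A rotation brings \<open>F b\<close> to the nonnegative real axis, where real part and
  modulus agree; at \<open>a\<close> the real part is at most the modulus. Summed along a chain,
  this estimate controls the endpoint of a lift.\<close>

lemma artanh_norm_le_poincare_dist:
  assumes hol: "F holomorphic_on unit_disk" and img: "F ` unit_disk \<subseteq> unit_disk"
    and a: "a \<in> unit_disk" and b: "b \<in> unit_disk"
  shows "2 * artanh (norm (F b)) \<le> 2 * artanh (norm (F a)) + poincare_dist a b"
proof -
  \<comment> \<open>If \<open>F b = 0\<close> then \<open>c = 0\<close>, which is harmless because
    the argument uses just \<open>norm c \<le> 1\<close>.\<close>
  define c where "c = cnj (sgn (F b))"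
  have c1: "norm c \<le> 1" by (simp add: c_def norm_sgn)
  have Re_b: "Re (c * F b) = norm (F b)"
    by (cases "F b = 0")
       (simp_all add: c_def sgn_eq complex_norm_square[symmetric] power2_eq_square mult.commute[of "cnj _"])
  have le: "norm (c * u) \<le> norm u" for u
    using c1 by (simp add: norm_mult mult_left_le_one_le)
  have Fa: "norm (F a) < 1" using img a by (simp add: image_subset_iff)
  have "2 * artanh (Re (c * F b)) - 2 * artanh (Re (c * F a)) \<le> poincare_dist a b"
    by (rule artanh_Re_diff_le_poincare_dist[OF _ _ a b])
       (use img in \<open>auto intro!: holomorphic_intros hol le_less_trans[OF le] simp: image_subset_iff\<close>)
  moreover have "artanh (Re (c * F a)) \<le> artanh (norm (F a))"
    using abs_Re_le_cmod[of "c * F a"] le[of "F a"] Fa by (subst artanh_le_iff) linarith+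
  ultimately show ?thesis unfolding Re_b by linarith
qed

section \<open>The strip and the disc\<close>

text \<open>This is the law of cosines. In the quotient of the cases \<theta> and -\<theta> the
  factor \<open>2 * exp t\<close> cancels.\<close>

lemma norm_exp_diff_square:
  "(norm (exp (Complex t \<phi>) - cis \<theta>))\<^sup>2 = 2 * exp t * (cosh t - cos (\<phi> - \<theta>))"
proof -
  have "exp t * cosh t * 2 = exp t * exp t + 1"
    by (simp add: cosh_def algebra_simps flip: exp_add)
  moreover have "(norm (exp (Complex t \<phi>) - cis \<theta>))\<^sup>2 =
      (exp t * cos \<phi> - cos \<theta>)\<^sup>2 + (exp t * sin \<phi> - sin \<theta>)\<^sup>2"
    by (simp add: cmod_power2 Re_exp Im_exp)
  moreover have "(exp t * cos \<phi> - cos \<theta>)\<^sup>2 + (exp t * sin \<phi> - sin \<theta>)\<^sup>2 =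
      exp t * exp t * ((cos \<phi>)\<^sup>2 + (sin \<phi>)\<^sup>2) + ((cos \<theta>)\<^sup>2 + (sin \<theta>)\<^sup>2)
      - 2 * exp t * (cos \<phi> * cos \<theta> + sin \<phi> * sin \<theta>)"
    by algebra
  ultimately show ?thesis
    by (simp add: cos_diff algebra_simps)
qed

lemma cosh_gt_cos:
  assumes "0 < (x::real)" "x < 2 * pi"
  shows "cos x < cosh (t::real)"
proof -
  have "sin (x / 2) > 0" using assms by (intro sin_gt_zero) auto
  then have "cos x < 1" using cos_double_sin[of "x / 2"] by simp
  also have "1 \<le> cosh t" by (rule cosh_real_ge_1)
  finally show ?thesis .
qed

text \<open>\<open>exp\<close> maps the strip \<open>0 < Im w < pi\<close> onto the upper half plane, and the Cayley transform
  centred at \<open>cis \<theta>\<close> takes it further onto the disc.\<close>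

definition strip_to_disk :: "real \<Rightarrow> complex \<Rightarrow> complex" where
  "strip_to_disk \<theta> w = (exp w - cis \<theta>) / (exp w - cis (- \<theta>))"

text \<open>The inverse Cayley transform lands in the upper half plane, where the principal
  \<open>Ln\<close> takes values in the strip.\<close>

definition disk_to_strip :: "real \<Rightarrow> complex \<Rightarrow> complex" where
  "disk_to_strip \<theta> b = Ln ((cis \<theta> - b * cis (- \<theta>)) / (1 - b))"

abbreviation strip :: "complex set" where
  "strip \<equiv> {w. 0 < Im w \<and> Im w < pi}"

text \<open>For q > 0, dividing by \<open>cosh q\<close> gives the sine of the height of the
  hyperbolic midpoint between \<i> \<theta> and \<i> \<theta> + 2 q.\<close>

definition midpoint_root :: "real \<Rightarrow> real \<Rightarrow> real" where
  "midpoint_root \<theta> q = sqrt ((sinh q)\<^sup>2 + (sin \<theta>)\<^sup>2)"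

text \<open>Radius of the largest disc about \<open>0\<close> that \<open>disk_to_strip \<theta>\<close> maps into \<open>\<bar>Re w\<bar> < q\<close>.\<close>

definition inj_radius :: "real \<Rightarrow> real \<Rightarrow> real" where
  "inj_radius \<theta> q = (midpoint_root \<theta> q - sin \<theta>) / sinh q"

context
  fixes \<theta> :: real
  assumes \<theta>: "0 < \<theta>" "\<theta> < pi"
begin

lemma sin_pos: "0 < sin \<theta>"
  using \<theta> by (rule sin_gt_zero)

lemma strip_to_disk_denom_nonzero:
  assumes "w \<in> strip"
  shows "exp w - cis (- \<theta>) \<noteq> 0"
proof -
  have "Im (exp w) > 0" using assms by (simp add: Im_exp sin_gt_zero)
  moreover have "Im (cis (- \<theta>)) < 0" using sin_pos by simp
  ultimately show ?thesis by (metis order.asym right_minus_eq)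
qed

lemma norm_strip_to_disk_square:
  assumes "w \<in> strip"
  shows "(norm (strip_to_disk \<theta> w))\<^sup>2 =
    (cosh (Re w) - cos (Im w - \<theta>)) / (cosh (Re w) - cos (Im w + \<theta>))"
  using norm_exp_diff_square[of "Re w" "Im w" \<theta>] norm_exp_diff_square[of "Re w" "Im w" "-\<theta>"]
  by (simp add: strip_to_disk_def norm_divide power_divide)

lemma strip_denom_pos:
  assumes "w \<in> strip"
  shows "cosh (Re w) - cos (Im w + \<theta>) > 0"
  using cosh_gt_cos[of "Im w + \<theta>" "Re w"] assms \<theta> by simp

lemma strip_to_disk_in_disk:
  assumes "w \<in> strip"
  shows "norm (strip_to_disk \<theta> w) < 1"
proof -
  have "sin (Im w) * sin \<theta> > 0" using assms \<theta> by (simp add: sin_gt_zero)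
  then have "(norm (strip_to_disk \<theta> w))\<^sup>2 < 1"
    using strip_denom_pos[OF assms]
    by (simp add: norm_strip_to_disk_square[OF assms] cos_add cos_diff)
  then show ?thesis by (simp add: abs_square_less_1)
qed

lemma strip_to_disk_holomorphic: "strip_to_disk \<theta> holomorphic_on strip"
  unfolding strip_to_disk_def[abs_def]
  by (intro holomorphic_intros) (use strip_to_disk_denom_nonzero in auto)

lemma Im_inverse_Cayley_pos:
  assumes "norm b < 1"
  shows "0 < Im ((cis \<theta> - b * cis (- \<theta>)) / (1 - b))"
proof -
  have "(Re b)\<^sup>2 + (Im b)\<^sup>2 < 1"
    using one_minus_norm_square_pos[OF assms] by (simp add: cmod_power2)
  moreover have "b \<noteq> 1" using assms by auto
  then have "(1 - Re b)\<^sup>2 + (Im b)\<^sup>2 > 0"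
    by (metis complex_eq_iff diff_eq_diff_eq one_complex.sel right_minus_eq sum_power2_gt_zero_iff)
  moreover have "Im ((cis \<theta> - b * cis (- \<theta>)) / (1 - b)) =
      sin \<theta> * (1 - ((Re b)\<^sup>2 + (Im b)\<^sup>2)) / ((1 - Re b)\<^sup>2 + (Im b)\<^sup>2)"
    by (simp add: Im_divide algebra_simps power2_eq_square)
  ultimately show ?thesis
    using sin_pos by simp
qed

lemma disk_to_strip_in_strip: "norm b < 1 \<Longrightarrow> disk_to_strip \<theta> b \<in> strip"
  using Im_Ln_pos_lt_imp[OF Im_inverse_Cayley_pos] by (simp add: disk_to_strip_def)

lemma exp_disk_to_strip:
  assumes "norm b < 1"
  shows "exp (disk_to_strip \<theta> b) = (cis \<theta> - b * cis (- \<theta>)) / (1 - b)"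
  unfolding disk_to_strip_def using Im_inverse_Cayley_pos[OF assms] by (subst exp_Ln) auto

lemma disk_to_strip_holomorphic: "disk_to_strip \<theta> holomorphic_on unit_disk"
  unfolding disk_to_strip_def[abs_def]
proof (intro holomorphic_intros)
  fix b assume "b \<in> unit_disk"
  then show "(cis \<theta> - b * cis (- \<theta>)) / (1 - b) \<notin> \<real>\<^sub>\<le>\<^sub>0"
    using Im_inverse_Cayley_pos[of b] by (auto simp: complex_nonpos_Reals_iff simp del: Im_divide)
qed auto

lemma cis_neq_cis_minus: "cis \<theta> \<noteq> cis (- \<theta>)"
  using sin_pos by (simp add: complex_eq_iff)

lemma strip_to_disk_disk_to_strip:
  assumes "norm b < 1"
  shows "strip_to_disk \<theta> (disk_to_strip \<theta> b) = b"
proof -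
  have b1: "1 - b \<noteq> 0" using assms by auto
  have "exp (disk_to_strip \<theta> b) - cis \<theta> = b * (cis \<theta> - cis (- \<theta>)) / (1 - b)"
    "exp (disk_to_strip \<theta> b) - cis (- \<theta>) = (cis \<theta> - cis (- \<theta>)) / (1 - b)"
    using b1 by (simp_all add: exp_disk_to_strip[OF assms] divide_simps) (simp_all add: algebra_simps)
  then show ?thesis
    using b1 cis_neq_cis_minus by (simp add: strip_to_disk_def)
qed

text \<open>Both sides have the same exponential and lie in a strip of height pi, too narrow for two
  points differing by a nonzero multiple of 2 pi \<i>.\<close>

lemma disk_to_strip_strip_to_disk:
  assumes w: "w \<in> strip"
  shows "disk_to_strip \<theta> (strip_to_disk \<theta> w) = w"
proof (rule exp_complex_eqI)
  have b: "norm (strip_to_disk \<theta> w) < 1" by (rule strip_to_disk_in_disk[OF w])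
  show "\<bar>Im (disk_to_strip \<theta> (strip_to_disk \<theta> w)) - Im w\<bar> < 2 * pi"
    using w disk_to_strip_in_strip[OF b] by auto
  have nz: "exp w - cis (- \<theta>) \<noteq> 0" by (rule strip_to_disk_denom_nonzero[OF w])
  have "cis \<theta> - strip_to_disk \<theta> w * cis (- \<theta>) =
      exp w * (cis \<theta> - cis (- \<theta>)) / (exp w - cis (- \<theta>))"
    "1 - strip_to_disk \<theta> w = (cis \<theta> - cis (- \<theta>)) / (exp w - cis (- \<theta>))"
    using nz by (simp_all add: strip_to_disk_def divide_simps) (simp_all add: algebra_simps)
  then show "exp (disk_to_strip \<theta> (strip_to_disk \<theta> w)) = exp w"
    using nz cis_neq_cis_minus by (simp add: exp_disk_to_strip[OF b])
qed

lemma disk_to_strip_0: "disk_to_strip \<theta> 0 = Complex 0 \<theta>"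
proof -
  have "strip_to_disk \<theta> (Complex 0 \<theta>) = 0"
    by (simp add: strip_to_disk_def exp_eq_polar)
  then show ?thesis
    using disk_to_strip_strip_to_disk[of "Complex 0 \<theta>"] \<theta> by simp
qed

section \<open>The least modulus over points of the strip with |Re w| at least q\<close>

lemma midpoint_root_square: "(midpoint_root \<theta> q)\<^sup>2 = (cosh q)\<^sup>2 - (cos \<theta>)\<^sup>2"
  unfolding midpoint_root_def by (subst real_sqrt_pow2) (auto simp: cosh_square_eq sin_squared_eq abs_square_le_1)

lemma midpoint_root_gt: "q > 0 \<Longrightarrow> sin \<theta> < midpoint_root \<theta> q"
  unfolding midpoint_root_def by (rule real_less_rsqrt) simp

text \<open>Factoring the square of \<open>sinh q\<close> as a difference of squares brings the
  radius into the same form as \<open>norm_strip_to_disk_square\<close>.\<close>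

lemma inj_radius_square:
  assumes "q > 0"
  shows "(inj_radius \<theta> q)\<^sup>2 = (midpoint_root \<theta> q - sin \<theta>) / (midpoint_root \<theta> q + sin \<theta>)"
proof -
  let ?Q = "midpoint_root \<theta> q"
  have "(sinh q)\<^sup>2 = (?Q - sin \<theta>) * (?Q + sin \<theta>)"
    by (simp add: midpoint_root_def algebra_simps flip: power2_eq_square)
  then have "(inj_radius \<theta> q)\<^sup>2 = (?Q - sin \<theta>)\<^sup>2 / ((?Q - sin \<theta>) * (?Q + sin \<theta>))"
    by (simp add: inj_radius_def power_divide)
  then show ?thesis
    using midpoint_root_gt[OF assms] by (simp add: power2_eq_square)
qed

lemma inj_radius_bounds:
  assumes "q > 0"
  shows "0 < inj_radius \<theta> q" "inj_radius \<theta> q < 1"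
proof -
  show pos: "0 < inj_radius \<theta> q"
    using midpoint_root_gt[OF assms] assms by (simp add: inj_radius_def)
  have "(inj_radius \<theta> q)\<^sup>2 < 1"
    using sin_pos midpoint_root_gt[OF assms] by (simp add: inj_radius_square[OF assms])
  then show "inj_radius \<theta> q < 1"
    using pos by (simp add: abs_square_less_1)
qed

lemma norm_strip_to_disk_ge:
  assumes w: "w \<in> strip" and q: "q > 0" "q \<le> \<bar>Re w\<bar>"
  shows "inj_radius \<theta> q \<le> norm (strip_to_disk \<theta> w)"
proof (rule power2_le_imp_le)
  let ?Q = "midpoint_root \<theta> q" and ?\<phi> = "Im w"
  let ?X = "cosh (Re w) - cos ?\<phi> * cos \<theta>" and ?Y = "sin ?\<phi> * sin \<theta>"
  have sin\<phi>: "sin ?\<phi> > 0" using w by (simp add: sin_gt_zero)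
  \<comment> \<open>Lagrange's identity for (Q, cos \<theta>) and the unit vector (sin \<phi>, cos
    \<phi>). The first vector has length \<open>cosh q\<close>, so this is Cauchy-Schwarz.\<close>
  have "(?Q * sin ?\<phi> + cos \<theta> * cos ?\<phi>)\<^sup>2 + (?Q * cos ?\<phi> - cos \<theta> * sin ?\<phi>)\<^sup>2
      = (?Q\<^sup>2 + (cos \<theta>)\<^sup>2) * ((sin ?\<phi>)\<^sup>2 + (cos ?\<phi>)\<^sup>2)"
    by algebra
  also have "\<dots> = (cosh q)\<^sup>2" by (simp add: midpoint_root_square)
  finally have "(?Q * sin ?\<phi> + cos \<theta> * cos ?\<phi>)\<^sup>2 \<le> (cosh q)\<^sup>2"
    by (smt (verit) zero_le_power2)
  then have "?Q * sin ?\<phi> + cos \<theta> * cos ?\<phi> \<le> cosh q"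
    by (rule power2_le_imp_le) simp
  also have "cosh q \<le> cosh (Re w)"
    using q by (metis abs_ge_zero cosh_real_abs cosh_real_nonneg_le_iff less_imp_le)
  finally have "?Q * sin ?\<phi> \<le> ?X" by (simp add: mult.commute)
  then have "?Q * sin ?\<phi> * sin \<theta> \<le> ?X * sin \<theta>"
    using sin_pos by (intro mult_right_mono) auto
  then have "(?Q - sin \<theta>) * (?X + ?Y) \<le> (?X - ?Y) * (?Q + sin \<theta>)"
    by (simp add: algebra_simps)
  moreover have "?X + ?Y > 0" using strip_denom_pos[OF w] by (simp add: cos_add)
  moreover have "?Q + sin \<theta> > 0" using midpoint_root_gt[OF q(1)] sin_pos by simp
  ultimately have "(?Q - sin \<theta>) / (?Q + sin \<theta>) \<le> (?X - ?Y) / (?X + ?Y)"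
    by (simp add: divide_simps mult_ac)
  then show "(inj_radius \<theta> q)\<^sup>2 \<le> (norm (strip_to_disk \<theta> w))\<^sup>2"
    by (simp add: inj_radius_square[OF q(1)] norm_strip_to_disk_square[OF w] cos_add cos_diff
        diff_diff_eq diff_diff_eq2 diff_add_eq)
qed auto

text \<open>The witnesses are the hyperbolic midpoints of \<open>\<i> \<theta>\<close> and \<open>\<i> \<theta> \<plusminus> 2 q\<close>.\<close>

lemma norm_strip_to_disk_attained:
  assumes q: "q > 0"
  obtains \<phi> where "0 < \<phi>" "\<phi> < pi"
    "norm (strip_to_disk \<theta> (Complex q \<phi>)) = inj_radius \<theta> q"
    "norm (strip_to_disk \<theta> (Complex (- q) \<phi>)) = inj_radius \<theta> q"
proof -
  let ?Q = "midpoint_root \<theta> q"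
  \<comment> \<open>The case of equality in Cauchy-Schwarz: (sin \<phi>, cos \<phi>) is (Q, cos
    \<theta>) divided by its length \<open>cosh q\<close>.\<close>
  define \<phi> where "\<phi> = arccos (cos \<theta> / cosh q)"
  have C1: "cosh q > 1" using q using cosh_real_strict_mono[of 0 q] by simp
  have "\<bar>cos \<theta>\<bar> < cosh q" using abs_cos_le_one[of \<theta>] C1 by linarith
  then have less: "-1 < cos \<theta> / cosh q" "cos \<theta> / cosh q < 1"
    using C1 by (auto simp: divide_simps abs_less_iff)
  then have \<phi>: "0 < \<phi>" "\<phi> < pi" using arccos_lt_bounded by (auto simp: \<phi>_def)
  have cos: "cos \<phi> = cos \<theta> / cosh q" using less by (simp add: \<phi>_def)
  have Qpos: "?Q > 0" using midpoint_root_gt[OF q] sin_pos by simp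
  have "(sin \<phi>)\<^sup>2 = (?Q / cosh q)\<^sup>2"
    using C1 by (simp add: sin_squared_eq cos power_divide midpoint_root_square diff_divide_distrib)
  then have sin: "sin \<phi> = ?Q / cosh q"
    using \<phi> Qpos C1 by (simp add: sin_gt_zero less_imp_le)
  have X: "cosh q - cos \<phi> * cos \<theta> = ?Q\<^sup>2 / cosh q"
    unfolding cos midpoint_root_square diff_divide_distrib using C1 by (simp add: power2_eq_square)
  have r: "(cosh q - cos \<phi> * cos \<theta> - sin \<phi> * sin \<theta>) / (cosh q - cos \<phi> * cos \<theta> + sin \<phi> * sin \<theta>)
      = (?Q - sin \<theta>) / (?Q + sin \<theta>)"
  proof -
    have "?Q\<^sup>2 / cosh q - sin \<phi> * sin \<theta> = ?Q / cosh q * (?Q - sin \<theta>)"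
      "?Q\<^sup>2 / cosh q + sin \<phi> * sin \<theta> = ?Q / cosh q * (?Q + sin \<theta>)"
      by (simp_all add: sin power2_eq_square algebra_simps add_divide_distrib diff_divide_distrib)
    then show ?thesis unfolding X using Qpos C1 by simp
  qed
  \<comment> \<open>The modulus depends on the real part through \<open>cosh\<close> alone, so q and
    -q are treated together.\<close>
  have "norm (strip_to_disk \<theta> (Complex x \<phi>)) = inj_radius \<theta> q" if "cosh x = cosh q" for x
  proof (rule power2_eq_imp_eq)
    show "(norm (strip_to_disk \<theta> (Complex x \<phi>)))\<^sup>2 = (inj_radius \<theta> q)\<^sup>2"
      using \<phi> r by (simp add: norm_strip_to_disk_square inj_radius_square[OF q] cos_add cos_diff
          that diff_diff_eq diff_add_eq diff_diff_eq2 del: cosh_real_eq_iff)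
  qed (use inj_radius_bounds[OF q] in auto)
  with \<phi> that show thesis by simp
qed

end

section \<open>The universal covering of the annulus\<close>

lemma holomorphic_log_unit_disk:
  assumes "f holomorphic_on unit_disk" "\<And>x. x \<in> unit_disk \<Longrightarrow> f x \<noteq> 0"
  obtains g where "g holomorphic_on unit_disk" "\<And>x. x \<in> unit_disk \<Longrightarrow> f x = exp (g x)"
proof -
  have "simply_connected unit_disk"
    by (simp add: convex_imp_simply_connected)
  then have "\<exists>g. g holomorphic_on unit_disk \<and> (\<forall>x\<in>unit_disk. f x = exp (g x))"
    unfolding simply_connected_eq_holomorphic_log[OF open_ball] using assms by blast
  with that show thesis by blast
qed

text \<open>\<open>norm_z\<close> is the formula for \<theta> in terms of z solved for the modulus.
  Together with the bounds on \<theta> it puts z in the annulus.\<close>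

locale pointed_annulus =
  fixes r \<theta> :: real and z :: complex
  assumes r: "0 < r" "r < 1" and \<theta>: "0 < \<theta>" "\<theta> < pi"
    and norm_z: "norm z = exp (ln r * \<theta> / pi)"
begin

definition strip_cover :: "complex \<Rightarrow> complex" where
  "strip_cover w = z * exp (- \<i> * of_real (ln r / pi) * (w - \<i> * of_real \<theta>))"

definition disk_cover :: "complex \<Rightarrow> complex" where
  "disk_cover b = strip_cover (disk_to_strip \<theta> b)"

text \<open>Half of the translation length of the deck transformations of \<open>strip_cover\<close>.\<close>

definition half_period :: real where
  "half_period = - pi\<^sup>2 / ln r"

lemma ln_r: "ln r < 0"
  using r by simp

lemma half_period_pos: "half_period > 0"
  using ln_r by (simp add: half_period_def divide_pos_neg)

lemma z_nonzero: "z \<noteq> 0"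
  using norm_z by (metis exp_gt_zero less_irrefl norm_zero)

lemma annulus_nonzero: "w \<in> annulus r \<Longrightarrow> w \<noteq> 0"
  using r by (auto simp: annulus_def)

lemma norm_strip_cover: "norm (strip_cover w) = exp (ln r * Im w / pi)"
proof -
  have "norm (strip_cover w) = exp (ln r * \<theta> / pi) * exp (ln r / pi * (Im w - \<theta>))"
    by (simp add: strip_cover_def norm_mult norm_z)
  then show ?thesis
    by (simp add: diff_divide_distrib right_diff_distrib flip: exp_add)
qed

lemma strip_cover_in_annulus_iff: "strip_cover w \<in> annulus r \<longleftrightarrow> w \<in> strip"
proof -
  have "r < exp (ln r * Im w / pi) \<longleftrightarrow> ln r < ln r * Im w / pi"
    using r by (metis exp_less_cancel_iff exp_ln)
  also have "\<dots> \<longleftrightarrow> Im w < pi"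
    using ln_r by (simp add: less_divide_eq)
  finally show ?thesis
    using ln_r by (auto simp: annulus_def norm_strip_cover divide_less_0_iff mult_less_0_iff)
qed

lemma strip_cover_eq_iff:
  "strip_cover w = strip_cover w' \<longleftrightarrow> (\<exists>n::int. w = w' + of_real (2 * half_period * of_int n))"
proof -
  have eq: "- \<i> * of_real (ln r / pi) * (w - \<i> * of_real \<theta>) =
      - \<i> * of_real (ln r / pi) * (w' - \<i> * of_real \<theta>) + of_real (of_int (2 * n) * pi) * \<i> \<longleftrightarrow>
      w = w' + of_real (2 * half_period * of_int n)" for n :: int
  proof -
    let ?c = "- \<i> * of_real (ln r / pi) :: complex"
    \<comment> \<open>The factor \<open>?c\<close> turns the real translation by
      \<open>2 * half_period * n\<close> into the period 2 pi n \<i> of \<open>exp\<close>.\<close>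
    have "ln r / pi * (2 * half_period * of_int n) = - (of_int (2 * n) * pi)"
      using ln_r by (simp add: half_period_def power2_eq_square)
    then have p: "?c * of_real (2 * half_period * of_int n) = of_real (of_int (2 * n) * pi) * \<i>"
      unfolding mult.assoc of_real_mult[symmetric] by simp
    have "?c \<noteq> 0" using ln_r by simp
    then have "?c * (w - \<i> * of_real \<theta>) = ?c * (w' - \<i> * of_real \<theta> + of_real (2 * half_period * of_int n))
        \<longleftrightarrow> w - \<i> * of_real \<theta> = w' - \<i> * of_real \<theta> + of_real (2 * half_period * of_int n)"
      by (simp only: mult_cancel_left simp_thms)
    then show ?thesis
      unfolding p[symmetric] distrib_left[symmetric] by (simp add: algebra_simps)
  qed
  have "strip_cover w = strip_cover w' \<longleftrightarrow>
      exp (- \<i> * of_real (ln r / pi) * (w - \<i> * of_real \<theta>)) =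
      exp (- \<i> * of_real (ln r / pi) * (w' - \<i> * of_real \<theta>))"
    using z_nonzero by (simp add: strip_cover_def)
  then show ?thesis
    by (simp only: exp_eq eq)
qed

lemma disk_cover_0: "disk_cover 0 = z"
proof -
  have "Complex 0 \<theta> - \<i> * of_real \<theta> = 0" by (simp add: complex_eq_iff)
  then show ?thesis by (simp add: disk_cover_def disk_to_strip_0[OF \<theta>] strip_cover_def)
qed

lemma disk_cover_strip_to_disk: "w \<in> strip \<Longrightarrow> disk_cover (strip_to_disk \<theta> w) = strip_cover w"
  by (simp add: disk_cover_def disk_to_strip_strip_to_disk[OF \<theta>])

lemma disk_cover_holomorphic: "disk_cover holomorphic_on unit_disk"
  unfolding disk_cover_def[abs_def] strip_cover_def
  by (intro holomorphic_intros disk_to_strip_holomorphic[OF \<theta>])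

lemma disk_cover_image: "disk_cover ` unit_disk \<subseteq> annulus r"
  using disk_to_strip_in_strip[OF \<theta>] by (auto simp: disk_cover_def strip_cover_in_annulus_iff)

section \<open>Lifting discs and chains through the covering\<close>

lemma disk_cover_lift:
  assumes hol: "f holomorphic_on unit_disk" and img: "f ` unit_disk \<subseteq> annulus r"
    and a: "a \<in> unit_disk" and u: "u \<in> unit_disk" and base: "disk_cover u = f a"
  obtains F where "F holomorphic_on unit_disk" "F ` unit_disk \<subseteq> unit_disk" "F a = u"
    "\<And>x. x \<in> unit_disk \<Longrightarrow> disk_cover (F x) = f x"
proof -
  have "f x \<noteq> 0" if "x \<in> unit_disk" for x
    using img that annulus_nonzero by blast
  then have "f x / z \<noteq> 0" if "x \<in> unit_disk" for x
    using that z_nonzero by simp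
  moreover have "(\<lambda>x. f x / z) holomorphic_on unit_disk"
    using z_nonzero by (intro holomorphic_intros hol) auto
  ultimately obtain g where g: "g holomorphic_on unit_disk"
    and fg: "\<And>x. x \<in> unit_disk \<Longrightarrow> f x / z = exp (g x)"
    using holomorphic_log_unit_disk[of "\<lambda>x. f x / z"] by blast
  \<comment> \<open>Solves \<open>strip_cover (W x) = f x\<close> by means of the logarithm
    \<open>g\<close> of \<open>f x / z\<close>.\<close>
  define W where "W x = \<i> * of_real \<theta> + \<i> * of_real (pi / ln r) * g x" for x
  have cov_W: "strip_cover (W x) = f x" if "x \<in> unit_disk" for x
  proof -
    have "- \<i> * of_real (ln r / pi) * (W x - \<i> * of_real \<theta>) = g x"
      using ln_r by (simp add: W_def)
    then have "strip_cover (W x) = z * (f x / z)"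
      by (simp only: strip_cover_def fg[OF that])
    then show ?thesis using z_nonzero by simp
  qed
  have "strip_cover (disk_to_strip \<theta> u) = strip_cover (W a)"
    using base cov_W[OF a] by (simp add: disk_cover_def)
  then obtain n :: int where n: "disk_to_strip \<theta> u = W a + of_real (2 * half_period * of_int n)"
    unfolding strip_cover_eq_iff by blast
  \<comment> \<open>A deck translation moves the lift so that it passes through the prescribed point
    over \<open>f a\<close>.\<close>
  define V where "V x = W x + of_real (2 * half_period * of_int n)" for x
  have cov_V: "strip_cover (V x) = f x" if "x \<in> unit_disk" for x
  proof -
    have "strip_cover (V x) = strip_cover (W x)" unfolding strip_cover_eq_iff V_def by blast
    then show ?thesis using cov_W[OF that] by simp
  qed
  \<comment> \<open>\<open>strip_cover\<close> is defined on the whole plane and takes values in the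
    annulus exactly on the strip, so a lift of \<open>f\<close> stays in the strip.\<close>
  have V: "V x \<in> strip" if "x \<in> unit_disk" for x
    unfolding strip_cover_in_annulus_iff[symmetric] cov_V[OF that] using img that by blast
  show thesis
  proof
    have "V holomorphic_on unit_disk"
      unfolding V_def W_def by (intro holomorphic_intros g)
    then show "strip_to_disk \<theta> \<circ> V holomorphic_on unit_disk"
      by (rule holomorphic_on_compose_gen[OF _ strip_to_disk_holomorphic[OF \<theta>]]) (use V in blast)
    show "(strip_to_disk \<theta> \<circ> V) ` unit_disk \<subseteq> unit_disk"
      using V strip_to_disk_in_disk[OF \<theta>] by auto
    show "(strip_to_disk \<theta> \<circ> V) a = u"
      using strip_to_disk_disk_to_strip[OF \<theta>, of u] u n by (simp add: V_def)
    show "disk_cover ((strip_to_disk \<theta> \<circ> V) x) = f x" if "x \<in> unit_disk" for x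
      using disk_cover_strip_to_disk[OF V[OF that]] cov_V[OF that] by simp
  qed
qed

text \<open>Each disc of the chain is lifted so that it starts where the lift of the previous one
  ended. The hyperbolic distance from 0 grows by at most the length of each link.\<close>

lemma kobayashi_chain_lift:
  assumes ch: "kobayashi_chain (annulus r) z w m a b f"
  obtains u where "u \<in> unit_disk" "disk_cover u = w"
    "2 * artanh (norm u) \<le> (\<Sum>i=1..m. poincare_dist (a i) (b i))"
proof -
  have lift_step: "\<exists>v\<in>unit_disk. disk_cover v = f i (b i) \<and>
      2 * artanh (norm v) \<le> 2 * artanh (norm u) + poincare_dist (a i) (b i)"
    if i: "i \<in> {1..m}" and u: "u \<in> unit_disk" "disk_cover u = f i (a i)" for i u
  proof -
    have ab: "a i \<in> unit_disk" "b i \<in> unit_disk" "f i holomorphic_on unit_disk"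
      "f i ` unit_disk \<subseteq> annulus r"
      using ch i unfolding kobayashi_chain_def by blast+
    obtain F where F: "F holomorphic_on unit_disk" "F ` unit_disk \<subseteq> unit_disk" "F (a i) = u"
      "\<And>x. x \<in> unit_disk \<Longrightarrow> disk_cover (F x) = f i x"
      using disk_cover_lift[OF ab(3,4,1) u] by metis
    show ?thesis
      using artanh_norm_le_poincare_dist[OF F(1,2) ab(1,2)] F ab
      by (intro bexI[of _ "F (b i)"]) (simp_all add: image_subset_iff)
  qed
  have "\<exists>u\<in>unit_disk. disk_cover u = f n (b n) \<and>
      2 * artanh (norm u) \<le> (\<Sum>i=1..n. poincare_dist (a i) (b i))" if "1 \<le> n" "n \<le> m" for n
    using that
  proof (induction n rule: dec_induct)
    case base
    \<comment> \<open>The lifted chain starts at 0, where \<open>artanh (norm u)\<close>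
      vanishes.\<close>
    have "disk_cover 0 = f 1 (a 1)"
      using ch by (simp add: disk_cover_0 kobayashi_chain_def)
    then show ?case
      using lift_step[of 1 0] base by simp
  next
    case (step n)
    then obtain u where u: "u \<in> unit_disk" "disk_cover u = f n (b n)"
      "2 * artanh (norm u) \<le> (\<Sum>i=1..n. poincare_dist (a i) (b i))" by auto
    have "f n (b n) = f (Suc n) (a (Suc n))"
      using ch step by (simp add: kobayashi_chain_def)
    with u(2) have "disk_cover u = f (Suc n) (a (Suc n))" by simp
    from lift_step[OF _ u(1) this] step.prems
    obtain v where "v \<in> unit_disk" "disk_cover v = f (Suc n) (b (Suc n))"
      "2 * artanh (norm v) \<le> 2 * artanh (norm u) + poincare_dist (a (Suc n)) (b (Suc n))"
      by auto
    with u(3) show ?case by (intro bexI[of _ v]) simp_all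
  qed
  from this[of m] obtain u where "u \<in> unit_disk" "disk_cover u = f m (b m)"
    "2 * artanh (norm u) \<le> (\<Sum>i=1..m. poincare_dist (a i) (b i))"
    using ch by (auto simp: kobayashi_chain_def)
  moreover have "f m (b m) = w" using ch by (simp add: kobayashi_chain_def)
  ultimately show thesis using that[of u] by simp
qed

text \<open>This chain with one link bounds the Kobayashi distance from above. As
  \<open>disk_cover\<close> is onto, such chains also make the infimum range over a nonempty
  set.\<close>

lemma kobayashi_chain_disk_cover:
  assumes "u \<in> unit_disk"
  shows "kobayashi_chain (annulus r) z (disk_cover u) 1 (\<lambda>_. 0) (\<lambda>_. u) (\<lambda>_. disk_cover)"
  using assms disk_cover_holomorphic disk_cover_image disk_cover_0
  by (simp add: kobayashi_chain_def)

lemma disk_cover_surj: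
  assumes "w \<in> annulus r"
  obtains u where "u \<in> unit_disk" "disk_cover u = w"
proof -
  define x where "x = \<i> * of_real \<theta> + \<i> * of_real (pi / ln r) * Ln (w / z)"
  have "- \<i> * of_real (ln r / pi) * (x - \<i> * of_real \<theta>) = Ln (w / z)"
    using ln_r by (simp add: x_def)
  then have "strip_cover x = w"
    using z_nonzero annulus_nonzero[OF assms] by (simp add: strip_cover_def)
  moreover from this have "x \<in> strip"
    using assms strip_cover_in_annulus_iff by blast
  ultimately show thesis
    using that[of "strip_to_disk \<theta> x"] strip_to_disk_in_disk[OF \<theta>, of x]
    by (simp add: disk_cover_strip_to_disk)
qed

text \<open>A chain shorter than \<open>s\<close> lifts to a chain from 0 ending at some
  \<open>u\<close> with \<open>2 * artanh (norm u) < s\<close>. Conversely the covering itself is a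
  chain with one link to each such point.\<close>

lemma kobayashi_ball_eq_image:
  "kobayashi_ball (annulus r) z s = disk_cover ` ball 0 (tanh (s / 2))"
proof (intro equalityI subsetI)
  fix w assume "w \<in> kobayashi_ball (annulus r) z s"
  then have w: "w \<in> annulus r" "kobayashi_dist (annulus r) z w < s"
    by (auto simp: kobayashi_ball_def)
  obtain v where "v \<in> unit_disk" "disk_cover v = w" using disk_cover_surj[OF w(1)] .
  then obtain m a b f where ch: "kobayashi_chain (annulus r) z w m a b f"
    and less: "(\<Sum>i=1..m. poincare_dist (a i) (b i)) < s"
    using cInf_lessD[OF _ w(2)[unfolded kobayashi_dist_def]] kobayashi_chain_disk_cover[of v] by blast
  obtain u where u: "u \<in> unit_disk" "disk_cover u = w"
    "2 * artanh (norm u) \<le> (\<Sum>i=1..m. poincare_dist (a i) (b i))"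
    using kobayashi_chain_lift[OF ch] .
  then have "norm u < tanh (s / 2)"
    using less by (subst artanh_less_iff[symmetric]) auto
  with u show "w \<in> disk_cover ` ball 0 (tanh (s / 2))" by auto
next
  fix w assume "w \<in> disk_cover ` ball 0 (tanh (s / 2))"
  then obtain u where u: "norm u < tanh (s / 2)" "w = disk_cover u" by auto
  then have u1: "u \<in> unit_disk" using tanh_real_lt_1[of "s / 2"] by simp
  have "kobayashi_dist (annulus r) z w \<le> (\<Sum>i=1..(1::nat). poincare_dist 0 u)"
    unfolding kobayashi_dist_def
  proof (rule cInf_lower)
    show "(\<Sum>i=1..(1::nat). poincare_dist 0 u) \<in>
        {\<Sum>i=1..m. poincare_dist (a i) (b i) | m a b f. kobayashi_chain (annulus r) z w m a b f}"
      using kobayashi_chain_disk_cover[OF u1] unfolding u(2)[symmetric]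
      by (intro CollectI exI[of _ "1::nat"] exI[of _ "\<lambda>_. 0"] exI[of _ "\<lambda>_. u"]
          exI[of _ "\<lambda>_. disk_cover"] conjI refl)
    show "bdd_below {\<Sum>i=1..m. poincare_dist (a i) (b i) | m a b f.
        kobayashi_chain (annulus r) z w m a b f}"
      by (rule bdd_belowI[of _ 0])
         (auto simp: kobayashi_chain_def intro!: sum_nonneg poincare_dist_nonneg)
  qed
  also have "\<dots> \<le> 2 * artanh (norm u)" using poincare_dist_0_le u1 by simp
  also have "\<dots> < s" using artanh_less_iff[of "norm u" "s / 2"] u u1 by simp
  finally show "w \<in> kobayashi_ball (annulus r) z s"
    using disk_cover_image u(2) u1 by (auto simp: kobayashi_ball_def)
qed

section \<open>The threshold for simply connected neighbourhoods\<close>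

lemma disk_cover_inj_on: "inj_on disk_cover (ball 0 (inj_radius \<theta> half_period))"
proof (rule inj_onI)
  note R1 = inj_radius_bounds(2)[OF \<theta> half_period_pos]
  have Re: "\<bar>Re (disk_to_strip \<theta> u)\<bar> < half_period" and u1: "norm u < 1"
    if "u \<in> ball 0 (inj_radius \<theta> half_period)" for u :: complex
  proof -
    show u1: "norm u < 1" using that R1 by simp
    show "\<bar>Re (disk_to_strip \<theta> u)\<bar> < half_period"
    proof (rule ccontr)
      assume "\<not> \<bar>Re (disk_to_strip \<theta> u)\<bar> < half_period"
      then have "inj_radius \<theta> half_period \<le> norm (strip_to_disk \<theta> (disk_to_strip \<theta> u))"
        by (intro norm_strip_to_disk_ge[OF \<theta> disk_to_strip_in_strip[OF \<theta> u1] half_period_pos]) simp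
      then show False
        unfolding strip_to_disk_disk_to_strip[OF \<theta> u1] using that by simp
    qed
  qed
  fix u v :: complex assume uv: "u \<in> ball 0 (inj_radius \<theta> half_period)" "v \<in> ball 0 (inj_radius \<theta> half_period)"
    and "disk_cover u = disk_cover v"
  then obtain n :: int where
    n: "disk_to_strip \<theta> u = disk_to_strip \<theta> v + of_real (2 * half_period * of_int n)"
    unfolding disk_cover_def strip_cover_eq_iff by blast
  then have "Re (disk_to_strip \<theta> u) - Re (disk_to_strip \<theta> v) = 2 * half_period * of_int n"
    by simp
  \<comment> \<open>Both real parts lie in an open interval of length
    \<open>2 * half_period\<close>, so the translation must be trivial.\<close>
  with Re[OF uv(1)] Re[OF uv(2)] have "\<bar>2 * half_period * of_int n\<bar> < 2 * half_period"
    by linarith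
  then have "n = 0" using half_period_pos by (simp add: abs_mult)
  with n have "strip_to_disk \<theta> (disk_to_strip \<theta> u) = strip_to_disk \<theta> (disk_to_strip \<theta> v)"
    by simp
  then show "u = v"
    unfolding strip_to_disk_disk_to_strip[OF \<theta> u1[OF uv(1)]]
      strip_to_disk_disk_to_strip[OF \<theta> u1[OF uv(2)]] .
qed

text \<open>A logarithm on the simply connected set \<open>f ` unit_disk\<close> pulls back to a branch of the
  logarithm of \<open>disk_cover\<close> that agrees on identified points, whereas the logarithm coming
  from \<open>strip_cover\<close> does not.\<close>

lemma disk_cover_image_not_in_simply_connected:
  assumes hol: "f holomorphic_on unit_disk" and inj: "inj_on f unit_disk"
    and img: "f ` unit_disk \<subseteq> annulus r"
    and R: "inj_radius \<theta> half_period < T" and T1: "T \<le> 1"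
  shows "\<not> disk_cover ` ball 0 T \<subseteq> f ` unit_disk"
proof
  assume sub: "disk_cover ` ball 0 T \<subseteq> f ` unit_disk"
  obtain \<phi> where \<phi>: "0 < \<phi>" "\<phi> < pi"
    and R\<phi>: "norm (strip_to_disk \<theta> (Complex half_period \<phi>)) = inj_radius \<theta> half_period"
      "norm (strip_to_disk \<theta> (Complex (- half_period) \<phi>)) = inj_radius \<theta> half_period"
    using norm_strip_to_disk_attained[OF \<theta> half_period_pos] .
  define b1 b2 where "b1 = strip_to_disk \<theta> (Complex half_period \<phi>)"
    and "b2 = strip_to_disk \<theta> (Complex (- half_period) \<phi>)"
  have "f x \<noteq> 0" if "x \<in> unit_disk" for x
    using img that annulus_nonzero by blast
  with holomorphic_log_unit_disk[OF hol] obtain l where l: "l holomorphic_on unit_disk"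
    and fl: "\<And>x. x \<in> unit_disk \<Longrightarrow> f x = exp (l x)"
    by blast
  obtain h where h: "h holomorphic_on (f ` unit_disk)"
    and hf: "\<And>x. x \<in> unit_disk \<Longrightarrow> h (f x) = x"
    using holomorphic_has_inverse[OF hol open_ball inj] by metis
  have h_img: "h ` f ` unit_disk \<subseteq> unit_disk" using hf by auto
  define \<Lambda> where "\<Lambda> u = Ln z + - \<i> * of_real (ln r / pi) * (disk_to_strip \<theta> u - \<i> * of_real \<theta>)" for u
  define \<delta> where "\<delta> u = l (h (disk_cover u)) - \<Lambda> u" for u
  have T_sub: "ball 0 T \<subseteq> unit_disk" using T1 by (simp add: subset_ball)
  have "l \<circ> h \<circ> disk_cover holomorphic_on ball 0 T"
    by (intro holomorphic_on_compose_gen[OF _ _ sub] holomorphic_on_compose_gen[OF h l h_img]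
        holomorphic_on_subset[OF disk_cover_holomorphic T_sub])
  then have "\<delta> holomorphic_on ball 0 T"
    unfolding \<delta>_def \<Lambda>_def
    by (intro holomorphic_intros holomorphic_on_subset[OF disk_to_strip_holomorphic[OF \<theta>] T_sub])
       (simp add: o_def)
  then have cont: "continuous_on (ball 0 T) \<delta>" by (rule holomorphic_on_imp_continuous_on)
  have exp_\<delta>: "exp (\<delta> u) = 1" if "u \<in> ball 0 T" for u :: complex
  proof -
    have "disk_cover u \<in> f ` unit_disk" using sub that by blast
    then obtain x where x: "x \<in> unit_disk" "disk_cover u = f x" by blast
    have "exp (\<Lambda> u) = disk_cover u"
      using z_nonzero unfolding \<Lambda>_def disk_cover_def strip_cover_def exp_add by simp
    moreover have "exp (l (h (disk_cover u))) = disk_cover u"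
      using x hf fl by simp
    moreover have "disk_cover u \<noteq> 0"
      using z_nonzero by (simp add: disk_cover_def strip_cover_def)
    ultimately show ?thesis by (simp add: \<delta>_def exp_diff)
  qed
  \<comment> \<open>\<open>\<delta>\<close> is a difference of two logarithms of
    \<open>disk_cover\<close>, so its values are multiples of 2 pi \<i>, and continuity on a
    connected disc makes it constant.\<close>
  have "\<delta> constant_on ball 0 T"
  proof (rule continuous_discrete_range_constant[OF _ cont])
    fix u :: complex assume u: "u \<in> ball 0 T"
    have "2 * pi \<le> norm (\<delta> v - \<delta> u)" if "v \<in> ball 0 T" "\<delta> v \<noteq> \<delta> u" for v
    proof (rule ccontr)
      assume "\<not> 2 * pi \<le> norm (\<delta> v - \<delta> u)"
      then have "\<bar>Im (\<delta> v) - Im (\<delta> u)\<bar> < 2 * pi"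
        using abs_Im_le_cmod[of "\<delta> v - \<delta> u"] by simp
      then show False
        using exp_complex_eqI[of "\<delta> v" "\<delta> u"] exp_\<delta>[OF u] exp_\<delta>[OF that(1)] that(2) by simp
    qed
    then show "\<exists>e>0. \<forall>v. v \<in> ball 0 T \<and> \<delta> v \<noteq> \<delta> u \<longrightarrow> e \<le> norm (\<delta> v - \<delta> u)"
      by (intro exI[of _ "2 * pi"]) auto
  qed auto
  moreover have "b1 \<in> ball 0 T" "b2 \<in> ball 0 T"
    using R R\<phi> by (auto simp: b1_def b2_def)
  ultimately have "\<delta> b1 = \<delta> b2" unfolding constant_on_def by metis
  moreover have in_strip: "Complex half_period \<phi> \<in> strip" "Complex (- half_period) \<phi> \<in> strip"
    using \<phi> by auto
  moreover have "disk_cover b1 = disk_cover b2"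
    unfolding b1_def b2_def in_strip[THEN disk_cover_strip_to_disk] strip_cover_eq_iff
    by (intro exI[of _ 1]) (simp add: complex_eq_iff)
  \<comment> \<open>The pulled-back logarithm agrees at \<open>b1\<close> and \<open>b2\<close>,
    which cover the same point, and so does \<open>\<delta>\<close>. But \<open>\<Lambda>\<close>
    separates them, since their strip coordinates differ by \<open>2 * half_period\<close>.\<close>
  ultimately have "\<Lambda> b1 = \<Lambda> b2" by (simp add: \<delta>_def)
  then have "disk_to_strip \<theta> b1 = disk_to_strip \<theta> b2"
    using ln_r by (simp add: \<Lambda>_def)
  then show False
    using half_period_pos in_strip disk_to_strip_strip_to_disk[OF \<theta>]
    by (simp add: b1_def b2_def complex_eq_iff)
qed

lemma kobayashi_ball_in_simply_connected_iff:
  "(\<exists>f. f holomorphic_on unit_disk \<and> inj_on f unit_disk \<and> f ` unit_disk \<subseteq> annulus r \<and>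
      kobayashi_ball (annulus r) z s \<subseteq> f ` unit_disk) \<longleftrightarrow> tanh (s / 2) \<le> inj_radius \<theta> half_period"
  (is "?L \<longleftrightarrow> ?R")
proof
  assume ?L
  then obtain f where f: "f holomorphic_on unit_disk" "inj_on f unit_disk"
    "f ` unit_disk \<subseteq> annulus r" "disk_cover ` ball 0 (tanh (s / 2)) \<subseteq> f ` unit_disk"
    unfolding kobayashi_ball_eq_image by auto
  show ?R
  proof (rule ccontr)
    assume "\<not> ?R"
    with disk_cover_image_not_in_simply_connected[OF f(1-3)] f(4) tanh_real_lt_1[of "s / 2"]
    show False by simp
  qed
next
  assume le: ?R
  let ?R = "inj_radius \<theta> half_period"
  note R = inj_radius_bounds[OF \<theta> half_period_pos]
  \<comment> \<open>The covering restricted to its disc of injectivity and rescaled to the unit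
    disc; the choice does not depend on \<open>s\<close>.\<close>
  let ?f = "\<lambda>x. disk_cover (of_real ?R * x)"
  have eq: "(\<lambda>x. of_real ?R * x) ` unit_disk = ball (0::complex) ?R"
    using ball_scale[of ?R "0::complex" 1] R by (simp add: scaleR_conv_of_real)
  have img: "?f ` unit_disk = disk_cover ` ball 0 ?R"
    unfolding eq[symmetric] image_image ..
  have sub: "ball (0::complex) ?R \<subseteq> unit_disk" using R by (simp add: subset_ball)
  have "?f holomorphic_on unit_disk"
    by (rule holomorphic_on_compose_gen[OF _ disk_cover_holomorphic, unfolded o_def])
       (use eq sub in \<open>auto intro!: holomorphic_intros\<close>)
  moreover have "inj_on ?f unit_disk"
    by (rule comp_inj_on[of "\<lambda>x. of_real ?R * x", unfolded o_def])
       (use R in \<open>simp_all only: eq disk_cover_inj_on\<close>, simp add: inj_on_def)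
  moreover have "?f ` unit_disk \<subseteq> annulus r"
    using img disk_cover_image sub by blast
  moreover have "kobayashi_ball (annulus r) z s \<subseteq> ?f ` unit_disk"
    unfolding kobayashi_ball_eq_image img by (intro image_mono subset_ball le)
  ultimately show ?L by (intro exI[of _ ?f] conjI)
qed

text \<open>The threshold is non-strict, so the supremum is a maximum, attained at twice the artanh
  of the radius.\<close>

lemma fridman_kobayashi_eq: "fridman_kobayashi (annulus r) z = inj_radius \<theta> half_period"
  unfolding fridman_kobayashi_def kobayashi_ball_in_simply_connected_iff
proof (rule cSup_eq_maximum)
  let ?R = "inj_radius \<theta> half_period"
  note R = inj_radius_bounds[OF \<theta> half_period_pos]
  have "tanh (artanh ?R) = ?R" using R by (intro tanh_artanh_real) auto
  moreover then have "artanh ?R > 0" using R by (metis tanh_real_pos_iff)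
  ultimately show "?R \<in> {tanh (s / 2) |s. 0 < s \<and> tanh (s / 2) \<le> ?R}"
    by (intro CollectI exI[of _ "2 * artanh ?R"]) simp_all
qed blast

end

section \<open>The radius in closed form\<close>

lemma inj_radius_exp:
  assumes q: "q > 0" and l: "l = exp (- q)"
  shows "inj_radius \<theta> q =
    (sqrt ((1 - l\<^sup>2)\<^sup>2 + 4 * l\<^sup>2 * (sin \<theta>)\<^sup>2) - 2 * l * sin \<theta>) / (1 - l\<^sup>2)"
proof -
  have pos: "l > 0" by (simp add: l)
  \<comment> \<open>Expanding the fraction in \<open>inj_radius\<close> by \<open>2 * l\<close>
    therefore yields the stated denominator.\<close>
  have sinh: "2 * l * sinh q = 1 - l\<^sup>2"
    by (simp add: l sinh_def power2_eq_square algebra_simps flip: exp_add)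
  have "(1 - l\<^sup>2)\<^sup>2 + 4 * l\<^sup>2 * (sin \<theta>)\<^sup>2 = (2 * l)\<^sup>2 * ((sinh q)\<^sup>2 + (sin \<theta>)\<^sup>2)"
    unfolding sinh[symmetric] by (simp add: power_mult_distrib algebra_simps)
  then have "sqrt ((1 - l\<^sup>2)\<^sup>2 + 4 * l\<^sup>2 * (sin \<theta>)\<^sup>2) = 2 * l * midpoint_root \<theta> q"
    using pos by (simp add: midpoint_root_def real_sqrt_mult)
  then have "(sqrt ((1 - l\<^sup>2)\<^sup>2 + 4 * l\<^sup>2 * (sin \<theta>)\<^sup>2) - 2 * l * sin \<theta>) / (1 - l\<^sup>2) =
      2 * l * (midpoint_root \<theta> q - sin \<theta>) / (2 * l * sinh q)"
    by (simp add: sinh right_diff_distrib)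
  then show ?thesis
    using pos by (simp add: inj_radius_def)
qed

theorem theorem3p1:
  fixes r lam theta :: real and z :: complex
  assumes "0 < r" and "r < 1"
    and "z \<in> annulus r"
    and "lam = exp (pi\<^sup>2 / ln r)"
    and "theta = pi * ln (norm z) / ln r"
  shows "fridman_kobayashi (annulus r) z =
    (sqrt ((1 - lam\<^sup>2)\<^sup>2 + 4 * lam\<^sup>2 * (sin theta)\<^sup>2) - 2 * lam * sin theta) / (1 - lam\<^sup>2)"
proof -
  have z: "r < norm z" "norm z < 1" using assms(3) by (auto simp: annulus_def)
  then have z0: "0 < norm z" using assms(1) by linarith
  have "ln r < ln (norm z)" using z z0 assms(1) by (subst ln_less_cancel_iff)
  moreover have "ln (norm z) < 0" using z z0 by (intro ln_less_zero)
  \<comment> \<open>Division by the negative number \<open>ln r\<close> reverses the inequalities ln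
    r < ln |z| < 0.\<close>
  ultimately have "0 < theta" "theta < pi" and ln_z: "ln r * theta / pi = ln (norm z)"
    by (auto simp: assms(5) zero_less_divide_iff mult_less_0_iff divide_less_eq)
  moreover have "norm z = exp (ln r * theta / pi)"
    using z0 by (subst ln_z) simp
  ultimately interpret pointed_annulus r theta z
    using assms(1,2) by unfold_locales
  show ?thesis
    unfolding fridman_kobayashi_eq
    by (rule inj_radius_exp[OF half_period_pos]) (simp add: assms(4) half_period_def)
qed

end
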